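(* Let $\mathcal{C}$ be a permutation class that contains neither the class of all layered permutations nor the class of all colayered permutations (that is, neither of these two classes is a subset of $\mathcal{C}$). Then there is a constant $c>0$ (depending only on $\mathcal{C}$) such that for every $n$, every permutation of length $n$ in $\mathcal{C}$ contains a monotone subsequence of length at least $cn$.
   Context: A permutation of length $n$ is a bijection $\pi$ of $\{1,\dots,n\}$, written as the sequence $\pi(1)\cdots\pi(n)$. A permutation $\pi$ contains a permutation $\sigma$ of length $m$ if there are indices $i_1<\cdots<i_m$ such that $\pi(i_1)\cdots\pi(i_m)$ is order isomorphic to $\sigma$ (same relative order); otherwise $\pi$ avoids $\sigma$. A permutation class is a set of permutations closed downward under this containment order: if $\pi$ is in the class and $\pi$ contains $\sigma$, then $\sigma$ is in the class. For permutations $\pi$ of length $m$ and $\sigma$ of length $n$, the sum $\pi\oplus\sigma$ is the permutation of length $m+n$ with $(\pi\oplus\sigma)(i)=\pi(i)$ for $i\le m$ and $(\pi\oplus\sigma)(i)=\sigma(i-m)+m$ for $i>m$; the skew sum $\pi\ominus\sigma$ is the permutation of length $m+n$ with $(\pi\ominus\sigma)(i)=\pi(i)+n$ for $i\le m$ and $(\pi\ominus\sigma)(i)=\sigma(i-m)$ for $i>m$. A layered permutation is a sum of (any finite number of) decreasing permutations, of arbitrary lengths; a colayered permutation is a skew sum of (any finite number of) increasing permutations, of arbitrary lengths. The layered permutations form a permutation class, as do the colayered permutations. A monotone subsequence is a subsequence of $\pi(1)\cdots\pi(n)$ that is either increasing or decreasing. *)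

theory Defs
  imports
    Complex_Main
    "HOL-Library.Sublist"
    "HOL-Combinatorics.Multiset_Permutations"
begin

text \<open>
  A permutation of length \<open>n\<close> is represented by its sequence of values
  \<open>\<pi>(1) \<dots> \<pi>(n)\<close>, a list over \<open>{1..n}\<close>. The list position \<open>i\<close> (counted from \<open>0\<close>) holds
  \<open>\<pi>(i + 1)\<close>. The empty permutation is included.
\<close>

type_synonym perm = "nat list"

definition is_perm :: "perm \<Rightarrow> bool" where
  "is_perm p \<longleftrightarrow> p \<in> permutations_of_set {1..length p}"

definition order_isomorphic :: "nat list \<Rightarrow> nat list \<Rightarrow> bool" where
  "order_isomorphic xs ys \<longleftrightarrow> length xs = length ys \<and>
     (\<forall>i < length xs. \<forall>j < length xs. xs ! i < xs ! j \<longleftrightarrow> ys ! i < ys ! j)"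

text \<open>Here \<^term>\<open>subseq t p\<close> selects entries at increasing, not necessarily adjacent positions.\<close>

definition contains :: "perm \<Rightarrow> perm \<Rightarrow> bool" where
  "contains p s \<longleftrightarrow> (\<exists>t. subseq t p \<and> order_isomorphic t s)"

definition perm_class :: "perm set \<Rightarrow> bool" where
  "perm_class C \<longleftrightarrow> (\<forall>p \<in> C. is_perm p) \<and>
     (\<forall>p \<in> C. \<forall>s. is_perm s \<and> contains p s \<longrightarrow> s \<in> C)"

definition perm_sum :: "perm \<Rightarrow> perm \<Rightarrow> perm" where
  "perm_sum p s = p @ map (\<lambda>x. x + length p) s"

definition skew_sum :: "perm \<Rightarrow> perm \<Rightarrow> perm" where
  "skew_sum p s = map (\<lambda>x. x + length s) p @ s"

definition increasing_perm :: "nat \<Rightarrow> perm" where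
  "increasing_perm n = [1..<Suc n]"

definition decreasing_perm :: "nat \<Rightarrow> perm" where
  "decreasing_perm n = rev [1..<Suc n]"

text \<open>The list \<open>ks\<close> gives the lengths of the layers; both sums are associative with unit \<open>[]\<close>.\<close>

definition layered_perms :: "perm set" where
  "layered_perms = {foldr perm_sum (map decreasing_perm ks) [] | ks. True}"

definition colayered_perms :: "perm set" where
  "colayered_perms = {foldr skew_sum (map increasing_perm ks) [] | ks. True}"

definition monotone_list :: "nat list \<Rightarrow> bool" where
  "monotone_list xs \<longleftrightarrow> sorted_wrt (<) xs \<or> sorted_wrt (>) xs"

end

theory Submission
  imports Defs
begin

text \<open>
  Every permutation of length \<open>n \<ge> 2\<close> contains two sets of at least \<open>n / 6\<close> entries, one
  wholly to the left of the other, such that either all of the first lie below all of the second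
  or all of them lie above: cut the plot into quadrants through the median position and the median
  value, and two opposite quadrants are both large (\<open>homogeneous_pair\<close>).

  Fix a layered permutation with layer lengths \<open>k # ks\<close> and a colayered one with layer lengths
  \<open>j # js\<close>, both missing from the class, and suppose that the left set \<open>A\<close> lies below the
  right set \<open>B\<close>. If \<open>A\<close> has no decreasing subsequence of length \<open>k\<close>, the Erdos-Szekeres
  argument gives \<open>A\<close> an increasing subsequence of length at least \<open>|A| / k\<close>, which is linear
  in \<open>n\<close>. If it has one, that subsequence can serve as the first layer, so \<open>B\<close> must avoid the
  layered permutation with the shorter sequence \<open>ks\<close>, while still avoiding the same colayered
  one. When \<open>A\<close> lies above \<open>B\<close>, the same holds with increasing and decreasing exchanged and
  \<open>js\<close> in place of \<open>j # js\<close>. Since \<open>B\<close> has linear size, induction on the total number of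
  layers finishes the argument (\<open>linear_monotone_or_layers\<close>); with no layers left there is
  nothing to prove, because the empty pattern cannot be avoided.

  The two cases differ only by reversing the order of the values. They are treated together by
  phrasing the statements for an order relation \<open>R\<close>, which is later \<open><\<close> or \<open>>\<close>.
\<close>

section \<open>Layered patterns over an order relation\<close>

text \<open>
  For \<open>R\<close> equal to \<open><\<close> these are the sequences order isomorphic to a layered permutation with
  layer lengths \<open>ks\<close>; for \<open>R\<close> equal to \<open>>\<close> they are those of colayered shape.
\<close>

fun layers :: "('a \<Rightarrow> 'a \<Rightarrow> bool) \<Rightarrow> nat list \<Rightarrow> 'a list \<Rightarrow> bool" where
  "layers R [] xs \<longleftrightarrow> xs = []"
| "layers R (k # ks) xs \<longleftrightarrow> (\<exists>ys zs. xs = ys @ zs \<and> length ys = k \<and>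
     sorted_wrt (\<lambda>x y. R y x) ys \<and> layers R ks zs \<and> (\<forall>y \<in> set ys. \<forall>z \<in> set zs. R y z))"

definition has_layers :: "('a \<Rightarrow> 'a \<Rightarrow> bool) \<Rightarrow> nat list \<Rightarrow> 'a list \<Rightarrow> bool" where
  "has_layers R ks xs \<longleftrightarrow> (\<exists>t. subseq t xs \<and> layers R ks t)"

lemma layers_append:
  assumes "length ys = k" "sorted_wrt (\<lambda>x y. R y x) ys" "layers R ks zs"
    and "\<And>y z. y \<in> set ys \<Longrightarrow> z \<in> set zs \<Longrightarrow> R y z"
  shows "layers R (k # ks) (ys @ zs)"
  unfolding layers.simps using assms by blast

lemma has_layers_Nil: "has_layers R [] xs"
  unfolding has_layers_def by force

lemma has_layers_subseq: "has_layers R ks xs \<Longrightarrow> subseq xs ys \<Longrightarrow> has_layers R ks ys"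
  unfolding has_layers_def using subseq_order.order_trans by blast

text \<open>
  How the induction removes a layer: if \<open>as\<close> contributes the first layer, then avoiding the
  pattern \<open>k # ks\<close> in \<open>as @ bs\<close> forces \<open>bs\<close> to avoid \<open>ks\<close>.
\<close>

lemma has_layers_Cons:
  assumes "subseq ys as" "length ys = k" "sorted_wrt (\<lambda>x y. R y x) ys"
    and "has_layers R ks bs" and "\<And>a b. a \<in> set as \<Longrightarrow> b \<in> set bs \<Longrightarrow> R a b"
  shows "has_layers R (k # ks) (as @ bs)"
proof -
  obtain t where t: "subseq t bs" "layers R ks t"
    using assms(4) unfolding has_layers_def by blast
  have "set ys \<subseteq> set as" "set t \<subseteq> set bs"
    using assms(1) t(1) by (auto dest: list_emb_set)
  hence "layers R (k # ks) (ys @ t)"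
    using assms(2,3,5) t(2) by (intro layers_append) auto
  moreover have "subseq (ys @ t) (as @ bs)"
    using assms(1) t(1) by (rule list_emb_append_mono)
  ultimately show ?thesis
    unfolding has_layers_def by blast
qed

section \<open>Such patterns are the layered and colayered permutations\<close>

text \<open>
  Two entries of such a sequence compare according to their layers alone: within a layer \<open>R\<close>
  holds backwards, between layers it holds forwards. Hence the lengths \<open>ks\<close> determine the relative
  order, and it suffices to find some sequence of this shape in order to find the layered
  permutation itself.
\<close>

lemma layers_pattern_unique:
  assumes "asymp R" "layers R ks s" "layers R ks t"
  shows "length s = length t \<and>
    (\<forall>i < length s. \<forall>j < length s. R (s ! i) (s ! j) \<longleftrightarrow> R (t ! i) (t ! j))"
  using assms(2,3)
proof (induction ks arbitrary: s t)
  case Nil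
  then show ?case by simp
next
  case (Cons k ks)
  obtain ys zs where s: "s = ys @ zs" "length ys = k" "sorted_wrt (\<lambda>x y. R y x) ys"
    "layers R ks zs" "\<And>y z. y \<in> set ys \<Longrightarrow> z \<in> set zs \<Longrightarrow> R y z"
    using Cons.prems(1) by auto
  obtain ys' zs' where t: "t = ys' @ zs'" "length ys' = k" "sorted_wrt (\<lambda>x y. R y x) ys'"
    "layers R ks zs'" "\<And>y z. y \<in> set ys' \<Longrightarrow> z \<in> set zs' \<Longrightarrow> R y z"
    using Cons.prems(2) by auto
  have IH: "length zs = length zs'"
    "\<And>i j. i < length zs \<Longrightarrow> j < length zs \<Longrightarrow> R (zs ! i) (zs ! j) \<longleftrightarrow> R (zs' ! i) (zs' ! j)"
    using Cons.IH[OF s(4) t(4)] by auto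
  have asym: "R x y \<Longrightarrow> \<not> R y x" for x y
    using assms(1) by (rule asympD)
  \<comment> \<open>Inside a layer the relation is decided by the positions.\<close>
  have dec: "R (us ! i) (us ! j) \<longleftrightarrow> j < i"
    if "sorted_wrt (\<lambda>x y. R y x) us" "i < length us" "j < length us" for us i j
    using sorted_wrt_nth_less[OF that(1), of i j] sorted_wrt_nth_less[OF that(1), of j i]
      that asym by (cases i j rule: linorder_cases) blast+
  show ?case
  proof (intro conjI allI impI)
    show "length s = length t"
      using s(1,2) t(1,2) IH(1) by simp
  next
    fix i j assume ij: "i < length s" "j < length s"
    consider "i < k" "j < k" | "i < k" "\<not> j < k" | "\<not> i < k" "j < k" | "\<not> i < k" "\<not> j < k"
      by blast
    then show "R (s ! i) (s ! j) \<longleftrightarrow> R (t ! i) (t ! j)"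
    proof cases
      case 1
      then show ?thesis
        using s t dec[OF s(3), of i j] dec[OF t(3), of i j] by (simp add: nth_append)
    next
      case 2
      then have "R (ys ! i) (zs ! (j - k))" "R (ys' ! i) (zs' ! (j - k))"
        using s t ij IH(1) by auto
      with 2 show ?thesis
        using s t by (simp add: nth_append)
    next
      case 3
      then have "R (ys ! j) (zs ! (i - k))" "R (ys' ! j) (zs' ! (i - k))"
        using s t ij IH(1) by auto
      with 3 show ?thesis
        using s t asym by (simp add: nth_append)
    next
      case 4
      then show ?thesis
        using s t ij IH by (simp add: nth_append)
    qed
  qed
qed

lemma length_increasing_perm [simp]: "length (increasing_perm k) = k"
  and set_increasing_perm [simp]: "set (increasing_perm k) = {1..k}"
  and sorted_increasing_perm: "sorted_wrt (<) (increasing_perm k)"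
  by (auto simp: increasing_perm_def simp del: upt_Suc)

lemma decreasing_perm_conv_rev: "decreasing_perm k = rev (increasing_perm k)"
  by (simp add: decreasing_perm_def increasing_perm_def)

lemma layers_shift:
  fixes m :: nat
  shows "layers (<) ks t \<Longrightarrow> layers (<) ks (map (\<lambda>x. x + m) t)"
proof (induction ks arbitrary: t)
  case (Cons k ks)
  then obtain ys zs where t: "t = ys @ zs" "length ys = k" "sorted_wrt (\<lambda>x y. y < x) ys"
    "layers (<) ks zs" "\<And>y z. y \<in> set ys \<Longrightarrow> z \<in> set zs \<Longrightarrow> y < z" by auto
  show ?case
    unfolding t(1) map_append
    by (rule layers_append) (use t Cons.IH in \<open>auto simp: sorted_wrt_map\<close>)
qed simp

lemma layered_perm_layers: "layers (<) ks (foldr perm_sum (map decreasing_perm ks) [])"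
proof (induction ks)
  case (Cons k ks)
  let ?t = "foldr perm_sum (map decreasing_perm ks) []"
  have "0 \<notin> set ?t"
    by (induction ks) (auto simp: perm_sum_def decreasing_perm_conv_rev)
  then have "0 < z" if "z \<in> set ?t" for z
    using that by (cases "z = 0") auto
  then have "layers (<) (k # ks) (decreasing_perm k @ map (\<lambda>x. x + k) ?t)"
    using layers_shift[OF Cons] sorted_increasing_perm
    by (intro layers_append) (fastforce simp: decreasing_perm_conv_rev sorted_wrt_rev)+
  moreover have "length (decreasing_perm k) = k"
    by (simp add: decreasing_perm_conv_rev)
  ultimately show ?case
    by (simp add: perm_sum_def[of "decreasing_perm k" ?t] del: layers.simps)
qed simp

lemma is_perm_iff: "is_perm p \<longleftrightarrow> distinct p \<and> set p = {1..length p}"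
  unfolding is_perm_def permutations_of_set_def by auto

lemma is_perm_Nil: "is_perm []"
  and is_perm_increasing: "is_perm (increasing_perm k)"
  and is_perm_decreasing: "is_perm (decreasing_perm k)"
  by (auto simp: is_perm_iff decreasing_perm_conv_rev)
    (auto simp: increasing_perm_def)

lemma is_perm_perm_sum:
  assumes "is_perm p" "is_perm s" shows "is_perm (perm_sum p s)"
proof -
  have "(\<lambda>x. x + length p) ` {1..length s} = {length p + 1..length p + length s}"
    by (simp add: add.commute)
  then show ?thesis
    using assms by (auto simp: is_perm_iff perm_sum_def distinct_map inj_on_def)
qed

lemma is_perm_skew_sum:
  assumes "is_perm p" "is_perm s" shows "is_perm (skew_sum p s)"
proof -
  have "(\<lambda>x. x + length s) ` {1..length p} = {length s + 1..length s + length p}"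
    by (simp add: add.commute)
  then show ?thesis
    using assms by (auto simp: is_perm_iff skew_sum_def distinct_map inj_on_def)
qed

lemma is_perm_layered: "is_perm (foldr perm_sum (map decreasing_perm ks) [])"
  by (induction ks) (auto intro: is_perm_perm_sum is_perm_Nil is_perm_decreasing)

lemma is_perm_colayered: "is_perm (foldr skew_sum (map increasing_perm ks) [])"
  by (induction ks) (auto intro: is_perm_skew_sum is_perm_Nil is_perm_increasing)

lemma colayered_perm_layers: "layers (>) ks (foldr skew_sum (map increasing_perm ks) [])"
proof (induction ks)
  case (Cons k ks)
  let ?t = "foldr skew_sum (map increasing_perm ks) []"
  have "z \<le> length ?t" if "z \<in> set ?t" for z
    using that is_perm_colayered[of ks] by (auto simp: is_perm_iff)
  then have "layers (>) (k # ks) (map (\<lambda>x. x + length ?t) (increasing_perm k) @ ?t)"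
    using Cons sorted_increasing_perm
    by (intro layers_append) (fastforce simp: sorted_wrt_map)+
  then show ?case
    by (simp add: skew_sum_def[of "increasing_perm k" ?t] del: layers.simps)
qed simp

lemma has_layers_contains_layered:
  assumes "has_layers (<) ks p"
  shows "contains p (foldr perm_sum (map decreasing_perm ks) [])"
  using assms layers_pattern_unique[OF _ _ layered_perm_layers, of ks]
  unfolding has_layers_def contains_def order_isomorphic_def by fastforce

lemma has_layers_contains_colayered:
  assumes "has_layers (>) ks p"
  shows "contains p (foldr skew_sum (map increasing_perm ks) [])"
  using assms layers_pattern_unique[OF _ _ colayered_perm_layers, of ks]
  unfolding has_layers_def contains_def order_isomorphic_def by fastforce

section \<open>A linear form of the Erdos-Szekeres theorem\<close>

text \<open>
  The colour of an entry is one less than the length of the longest \<open>R\<close>-descending subsequence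
  starting there. If an entry \<open>x\<close> is followed by \<open>y\<close> with \<open>R y x\<close>, then \<open>x\<close> can be put in front of
  the longest such subsequence from \<open>y\<close>, so their colours differ; a colour class is therefore
  \<open>R\<close>-ascending.
\<close>

lemma descent_colouring:
  assumes "transp R" "totalp R" "distinct xs"
  shows "\<exists>f :: 'a \<Rightarrow> nat. (\<forall>x \<in> set xs. \<exists>ys. subseq (x # ys) xs \<and>
            sorted_wrt (\<lambda>x y. R y x) (x # ys) \<and> length ys = f x) \<and>
          (\<forall>c. sorted_wrt R (filter (\<lambda>x. f x = c) xs))"
  using assms(3)
proof (induction xs)
  case Nil
  then show ?case by simp
next
  case (Cons x xs)
  then obtain f :: "'a \<Rightarrow> nat" where
    f: "\<And>y. y \<in> set xs \<Longrightarrow> \<exists>ys. subseq (y # ys) xs \<and> sorted_wrt (\<lambda>x y. R y x) (y # ys) \<and> length ys = f y"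
      "\<And>c. sorted_wrt R (filter (\<lambda>x. f x = c) xs)"
    by auto
  \<comment> \<open>A descending run from \<open>x\<close> continues with an entry of \<open>D\<close>, so the best colour in \<open>D\<close>
    decides that of \<open>x\<close>.\<close>
  define D where "D = {y \<in> set xs. R y x}"
  define c where "c = (if D = {} then 0 else Suc (Max (f ` D)))"
  have start: "\<exists>ys. subseq (x # ys) (x # xs) \<and> sorted_wrt (\<lambda>x y. R y x) (x # ys) \<and> length ys = c"
  proof (cases "D = {}")
    case True
    then show ?thesis by (auto simp: c_def)
  next
    case False
    then have "Max (f ` D) \<in> f ` D"
      by (intro Max_in) (auto simp: D_def)
    then obtain y where y: "y \<in> set xs" "R y x" "Max (f ` D) = f y"
      by (auto simp: D_def)
    obtain ys where ys: "subseq (y # ys) xs" "sorted_wrt (\<lambda>x y. R y x) (y # ys)" "length ys = f y"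
      using f(1)[OF y(1)] by blast
    have "sorted_wrt (\<lambda>x y. R y x) (x # y # ys)"
      using ys(2) y(2) assms(1) by (auto dest: transpD)
    with ys y(3) False show ?thesis
      by (intro exI[of _ "y # ys"]) (auto simp: c_def)
  qed
  have later: "\<exists>ys. subseq (y # ys) (x # xs) \<and> sorted_wrt (\<lambda>x y. R y x) (y # ys) \<and> length ys = f y"
    if "y \<in> set xs" for y
    using f(1)[OF that] by (blast intro: list_emb_Cons)
  have same: "R x y" if y: "y \<in> set xs" "f y = c" for y
  proof (rule ccontr)
    assume "\<not> R x y"
    moreover have "x \<noteq> y"
      using y(1) Cons.prems by auto
    ultimately have "y \<in> D"
      using y(1) assms(2) by (auto simp: D_def dest: totalpD)
    then have "f y < c"
      by (auto simp: c_def D_def less_Suc_eq_le intro!: Max_ge)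
    with y(2) show False by simp
  qed
  have filt: "filter (\<lambda>y. (f(x := c)) y = d) xs = filter (\<lambda>y. f y = d) xs" for d
    using Cons.prems by (intro filter_cong) auto
  show ?case
  proof (intro exI[of _ "f(x := c)"] conjI ballI allI)
    fix y assume "y \<in> set (x # xs)"
    then consider "y = x" | "y \<noteq> x" "y \<in> set xs"
      by auto
    then show "\<exists>ys. subseq (y # ys) (x # xs) \<and> sorted_wrt (\<lambda>x y. R y x) (y # ys) \<and>
        length ys = (f(x := c)) y"
    proof cases
      case 1
      then show ?thesis using start by (simp only: fun_upd_same)
    next
      case 2
      then show ?thesis using later[OF 2(2)] by (simp only: fun_upd_apply if_False)
    qed
  next
    fix d
    show "sorted_wrt R (filter (\<lambda>y. (f(x := c)) y = d) (x # xs))"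
      using f(2)[of d] filt[of d] same by auto
  qed
qed

text \<open>
  Without a descending subsequence of length \<open>k\<close> the colouring above uses only colours below
  \<open>k\<close>, and the largest colour class is long enough.
\<close>

lemma erdos_szekeres:
  assumes "transp R" "totalp R" "distinct xs"
  shows "(\<exists>ys. subseq ys xs \<and> length ys = k \<and> sorted_wrt (\<lambda>x y. R y x) ys) \<or>
         (\<exists>zs. subseq zs xs \<and> sorted_wrt R zs \<and> length xs \<le> k * length zs)"
proof -
  obtain f :: "'a \<Rightarrow> nat" where
    f: "\<And>x. x \<in> set xs \<Longrightarrow> \<exists>ys. subseq (x # ys) xs \<and> sorted_wrt (\<lambda>x y. R y x) (x # ys) \<and> length ys = f x"
      "\<And>c. sorted_wrt R (filter (\<lambda>x. f x = c) xs)"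
    using descent_colouring[OF assms] by blast
  show ?thesis
  proof (cases "\<exists>x \<in> set xs. k \<le> f x")
    case True
    then obtain x ys where ys: "subseq (x # ys) xs" "sorted_wrt (\<lambda>x y. R y x) (x # ys)"
      "k \<le> length ys"
      using f(1) by metis
    have "subseq (take k (x # ys)) xs"
      using ys(1) by (meson prefix_imp_subseq take_is_prefix subseq_order.order_trans)
    moreover have "sorted_wrt (\<lambda>x y. R y x) (take k (x # ys))"
      using ys(2) by (rule sorted_wrt_take)
    ultimately show ?thesis
      using ys(3) by (intro disjI1 exI[of _ "take k (x # ys)"]) simp
  next
    case False
    let ?cls = "\<lambda>c. filter (\<lambda>x. f x = c) xs"
    have total: "length xs = (\<Sum>c<k. length (?cls c))"
      using False
    proof (induction xs)
      case (Cons x xs)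
      have "(\<Sum>c<k. length (filter (\<lambda>y. f y = c) (x # xs))) =
          (\<Sum>c<k. (if f x = c then 1 else 0) + length (filter (\<lambda>y. f y = c) xs))"
        by (intro sum.cong) auto
      also have "\<dots> = 1 + length xs"
        using Cons by (subst sum.distrib) auto
      finally show ?case by simp
    qed simp
    have "\<exists>c. length xs \<le> k * length (?cls c)"
    proof (rule ccontr)
      assume "\<not> ?thesis"
      then have less: "k * length (?cls c) < length xs" for c
        by (simp add: not_le)
      then have "k > 0"
        using total by (cases "k = 0") auto
      then have "(\<Sum>c<k. k * length (?cls c)) < (\<Sum>c<k. length xs)"
        using less by (intro sum_strict_mono) auto
      then show False
        using total by (simp add: sum_distrib_left[symmetric])
    qed
    then show ?thesis
      using f(2) subseq_filter_left by blast
  qed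
qed

section \<open>Large homogeneous pairs\<close>

lemma ex_threshold:
  fixes xs :: "'a::linorder list"
  assumes "distinct xs" "m < length xs"
  shows "\<exists>v. length (filter (\<lambda>x. x < v) xs) = m"
proof -
  define s where "s = sort xs"
  define v where "v = s ! m"
  have s: "sorted_wrt (<) s" "length s = length xs"
    using assms(1) by (auto simp: s_def strict_sorted_iff)
  have "x < v" if "x \<in> set (take m s)" for x
    using that s assms(2) by (auto simp: in_set_conv_nth v_def intro!: sorted_wrt_nth_less[OF s(1)])
  moreover have "\<not> x < v" if "x \<in> set (drop m s)" for x
  proof -
    obtain i where "i < length (drop m s)" "x = drop m s ! i"
      using \<open>x \<in> set (drop m s)\<close> by (metis in_set_conv_nth)
    then have i: "m + i < length s" "x = s ! (m + i)"
      by auto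
    have "s ! m \<le> s ! (m + i)"
      using s(1) i(1) by (intro sorted_nth_mono) (auto simp: strict_sorted_iff)
    then show ?thesis using i by (simp add: v_def)
  qed
  ultimately have "filter (\<lambda>x. x < v) (take m s @ drop m s) = take m s"
    unfolding filter_append by simp
  then have "length (filter (\<lambda>x. x < v) s) = m"
    using s assms(2) by simp
  moreover have "length (filter (\<lambda>x. x < v) s) = length (filter (\<lambda>x. x < v) xs)"
    by (simp add: s_def filter_sort)
  ultimately show ?thesis by auto
qed

text \<open>
  The left half and the lower half both have \<open>m = \<lfloor>n / 2\<rfloor>\<close> entries. So the quadrants left-top
  \<open>LT\<close> and right-bottom \<open>RB\<close> have the same size \<open>m - |LB|\<close>, and \<open>RT\<close> is at least as large as
  \<open>LB\<close>. One of the two opposite pairs thus has both members of size at least \<open>m / 2\<close>, and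
  \<open>m \<ge> n / 3\<close> for \<open>n \<ge> 2\<close>.
\<close>

lemma homogeneous_pair:
  fixes xs :: "'a::linorder list"
  assumes "distinct xs" "length xs \<ge> 2"
  shows "\<exists>R \<in> {(<), (>)}. \<exists>as bs. subseq (as @ bs) xs \<and>
    (\<forall>a \<in> set as. \<forall>b \<in> set bs. R a b) \<and>
    length xs \<le> 6 * length as \<and> length xs \<le> 6 * length bs"
proof -
  define n m where "n = length xs" and "m = length xs div 2"
  obtain v where v: "length (filter (\<lambda>x. x < v) xs) = m"
    using ex_threshold[OF assms(1), of m] assms(2) unfolding m_def by fastforce
  define LB LT where "LB = filter (\<lambda>x. x < v) (take m xs)" and "LT = filter (\<lambda>x. \<not> x < v) (take m xs)"
  define RB RT where "RB = filter (\<lambda>x. x < v) (drop m xs)" and "RT = filter (\<lambda>x. \<not> x < v) (drop m xs)"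
  have left: "length LB + length LT = m" and right: "length RB + length RT = n - m"
    unfolding LB_def LT_def RB_def RT_def sum_length_filter_compl
    by (simp_all add: n_def m_def)
  have "filter (\<lambda>x. x < v) xs = LB @ RB"
    unfolding LB_def RB_def by (simp flip: filter_append)
  then have bottom: "length LB + length RB = m"
    using v by simp
  have third: "n \<le> 3 * m" "2 * m \<le> n"
    using assms(2) by (auto simp: n_def m_def)
  have sub: "subseq (filter P (take m xs) @ filter Q (drop m xs)) xs" for P Q
    using list_emb_append_mono[OF subseq_filter_left subseq_filter_left, of P "take m xs" Q "drop m xs"]
    by simp
  show ?thesis
  proof (cases "m \<le> 2 * length LB")
    case True
    have "n \<le> 6 * length LB" "n \<le> 6 * length RT"
      using True left right bottom third by linarith+
    moreover have "\<forall>a \<in> set LB. \<forall>b \<in> set RT. a < b"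
      by (auto simp: LB_def RT_def)
    ultimately show ?thesis
      using sub[of "\<lambda>x. x < v" "\<lambda>x. \<not> x < v"]
      unfolding n_def LB_def[symmetric] RT_def[symmetric]
      by (intro bexI[of _ "(<)"] exI[of _ LB] exI[of _ RT] conjI) auto
  next
    case False
    have "n \<le> 6 * length LT" "n \<le> 6 * length RB"
      using False left right bottom third by linarith+
    moreover have "\<forall>a \<in> set LT. \<forall>b \<in> set RB. a > b"
      by (auto simp: LT_def RB_def)
    ultimately show ?thesis
      using sub[of "\<lambda>x. \<not> x < v" "\<lambda>x. x < v"]
      unfolding n_def LT_def[symmetric] RB_def[symmetric]
      by (intro bexI[of _ "(>)"] exI[of _ LT] exI[of _ RB] conjI) auto
  qed
qed

section \<open>The induction on the number of layers\<close>

text \<open>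
  Either \<open>as\<close> supplies a first layer, so that the remaining layers cannot occur in \<open>bs\<close>, or it has
  an \<open>R\<close>-ascending subsequence of linear length.
\<close>

lemma layers_step:
  assumes "transp R" "totalp R" "distinct xs"
    and "subseq (as @ bs) xs" and "\<And>a b. a \<in> set as \<Longrightarrow> b \<in> set bs \<Longrightarrow> R a b"
    and "length xs \<le> 6 * length as" and "\<not> has_layers R (k # ks) xs"
  shows "\<not> has_layers R ks bs \<or>
    (\<exists>zs. subseq zs xs \<and> sorted_wrt R zs \<and> length xs \<le> 6 * k * length zs)"
proof -
  have "subseq as (as @ bs)"
    by (simp add: prefix_imp_subseq)
  then have sub: "subseq as xs"
    using assms(4) subseq_order.order_trans by blast
  then have "distinct as"
    using assms(3) subseq_conv_nths distinct_nthsI by metis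
  from erdos_szekeres[OF assms(1,2) this, of k] show ?thesis
  proof (elim disjE exE conjE)
    fix ys assume "subseq ys as" "length ys = k" "sorted_wrt (\<lambda>x y. R y x) ys"
    then have "\<not> has_layers R ks bs"
      using has_layers_Cons has_layers_subseq assms(4,5,7) by metis
    then show ?thesis ..
  next
    fix zs assume "subseq zs as" "sorted_wrt R zs" "length as \<le> k * length zs"
    moreover from this have "length xs \<le> 6 * k * length zs"
      using assms(6) by linarith
    ultimately show ?thesis
      using sub subseq_order.order_trans by blast
  qed
qed

lemma linear_monotone_or_layers:
  "\<exists>K. \<forall>xs. distinct xs \<longrightarrow> has_layers (<) ks xs \<or> has_layers (>) js xs \<or>
     (\<exists>zs. subseq zs xs \<and> monotone_list zs \<and> length xs \<le> K * length zs)"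
proof (induction "length ks + length js" arbitrary: ks js rule: less_induct)
  case less
  show ?case
  proof (cases "ks = [] \<or> js = []")
    case True
    then show ?thesis using has_layers_Nil by blast
  next
    case False
    then obtain k ks' j js' where ks: "ks = k # ks'" and js: "js = j # js'"
      by (meson list.exhaust)
    obtain K1 where K1: "\<And>xs. distinct xs \<Longrightarrow> has_layers (<) ks' xs \<or> has_layers (>) js xs \<or>
        (\<exists>zs. subseq zs xs \<and> monotone_list zs \<and> length xs \<le> K1 * length zs)"
      using less[of ks' js] ks by auto
    obtain K2 where K2: "\<And>xs. distinct xs \<Longrightarrow> has_layers (<) ks xs \<or> has_layers (>) js' xs \<or>
        (\<exists>zs. subseq zs xs \<and> monotone_list zs \<and> length xs \<le> K2 * length zs)"
      using less[of ks js'] js by auto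
    \<comment> \<open>The summands cover, in turn, sequences of length at most one, a first layer missing from the
      left part, and the two appeals to the induction hypothesis; the factor 6 is the loss in
      passing to one member of a homogeneous pair.\<close>
    define K where "K = 1 + 6 * k + 6 * j + 6 * K1 + 6 * K2"
    have K: "n \<le> K * l" if "n \<le> M * l" "M \<in> {1, 6 * k, 6 * j, 6 * K1, 6 * K2}" for n M l :: nat
    proof -
      have "M \<le> K" using that(2) by (auto simp: K_def)
      then show ?thesis using that(1) by (meson mult_le_mono1 order_trans)
    qed
    show ?thesis
    proof (intro exI[of _ K] allI impI)
      fix xs :: "nat list" assume dist: "distinct xs"
      let ?goal = "\<exists>zs. subseq zs xs \<and> monotone_list zs \<and> length xs \<le> K * length zs"
      have "?goal" if avoid: "\<not> has_layers (<) ks xs" "\<not> has_layers (>) js xs"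
      proof (cases "length xs \<ge> 2")
        case False
        then have "length xs = 0 \<or> length xs = 1" by linarith
        then have "monotone_list xs"
          by (auto simp: monotone_list_def length_Suc_conv)
        then show ?thesis
          using K[of "length xs" 1 "length xs"] by auto
      next
        case True
        then obtain R as bs where R: "R = (<) \<or> R = (>)" and sub: "subseq (as @ bs) xs"
          and rel: "\<And>a b. a \<in> set as \<Longrightarrow> b \<in> set bs \<Longrightarrow> R a b"
          and len: "length xs \<le> 6 * length as" "length xs \<le> 6 * length bs"
          using homogeneous_pair[OF dist True] by blast
        have "subseq bs (as @ bs)"
          by (simp add: subseq_drop_many)
        then have sub_bs: "subseq bs xs"
          using sub subseq_order.order_trans by blast
        then have dist_bs: "distinct bs" using dist subseq_conv_nths distinct_nthsI by metis
        have avoid_bs: "\<not> has_layers (<) ks bs" "\<not> has_layers (>) js bs"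
          using avoid sub_bs has_layers_subseq by blast+
        have from_bs: ?goal if zs: "subseq zs bs" "monotone_list zs" "length bs \<le> M * length zs"
          "M \<in> {K1, K2}" for zs M
        proof -
          have "length xs \<le> (6 * M) * length zs"
            using zs(3) len(2) by linarith
          then show ?thesis
            using zs sub_bs K[of "length xs" "6 * M" "length zs"] subseq_order.order_trans by blast
        qed
        from R show ?thesis
        proof
          assume lt: "R = (<)"
          have "transp R" "totalp R"
            using lt by simp_all
          from layers_step[OF this dist sub rel len(1)] avoid(1) ks lt
          show ?thesis
            using K1[OF dist_bs] avoid_bs from_bs K[of _ "6 * k"] unfolding monotone_list_def
            by (metis insertCI)
        next
          assume gt: "R = (>)"
          have "transp R" "totalp R"
            using gt by simp_all
          from layers_step[OF this dist sub rel len(1)] avoid(2) js gt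
          show ?thesis
            using K2[OF dist_bs] avoid_bs from_bs K[of _ "6 * j"] unfolding monotone_list_def
            by (metis insertCI)
        qed
      qed
      then show "has_layers (<) ks xs \<or> has_layers (>) js xs \<or> ?goal"
        by blast
    qed
  qed
qed

theorem theorem1:
  fixes C :: "perm set"
  assumes "perm_class C"
    and "\<not> layered_perms \<subseteq> C"
    and "\<not> colayered_perms \<subseteq> C"
  shows "\<exists>c::real. c > 0 \<and>
    (\<forall>n. \<forall>p \<in> C. length p = n \<longrightarrow>
      (\<exists>xs. subseq xs p \<and> monotone_list xs \<and> real (length xs) \<ge> c * real n))"
proof -
  obtain ks where ks: "foldr perm_sum (map decreasing_perm ks) [] \<notin> C"
    using assms(2) unfolding layered_perms_def by blast
  obtain js where js: "foldr skew_sum (map increasing_perm js) [] \<notin> C"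
    using assms(3) unfolding colayered_perms_def by blast
  have avoids: "\<not> has_layers (<) ks p" "\<not> has_layers (>) js p" if "p \<in> C" for p
    using that ks js assms(1) is_perm_layered is_perm_colayered
      has_layers_contains_layered has_layers_contains_colayered
    unfolding perm_class_def by blast+
  obtain K where K: "\<And>xs. distinct xs \<Longrightarrow> has_layers (<) ks xs \<or> has_layers (>) js xs \<or>
     (\<exists>zs. subseq zs xs \<and> monotone_list zs \<and> length xs \<le> K * length zs)"
    using linear_monotone_or_layers by metis
  show ?thesis
  \<comment> \<open>\<open>K + 1\<close> rather than \<open>K\<close>, since \<open>K\<close> may be zero.\<close>
  proof (intro exI[of _ "1 / (real K + 1)"] conjI allI ballI impI)
    fix n p assume p: "p \<in> C" "length p = n"
    have "distinct p"
      using assms(1) p(1) by (auto simp: perm_class_def is_perm_iff)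
    then obtain zs where zs: "subseq zs p" "monotone_list zs" "n \<le> K * length zs"
      using K avoids p by blast
    have "real n \<le> real (K * length zs)"
      using zs(3) of_nat_mono by blast
    also have "\<dots> \<le> (real K + 1) * real (length zs)"
      by (simp add: algebra_simps)
    finally have "1 / (real K + 1) * real n \<le> real (length zs)"
      by (simp add: field_simps)
    with zs show "\<exists>xs. subseq xs p \<and> monotone_list xs \<and> real (length xs) \<ge> 1 / (real K + 1) * real n"
      by blast
  qed simp
qed

end
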